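(* The set of null 3-spaces of $\mathbb R^{3,3}$ can be decomposed into two subsets (its connected components) such that: within each subset, the intersection of any two different elements has dimension $1$; and for any two elements, one from each subset, their intersection has dimension $0$ or $2$.
   Context: $\mathbb R^{3,3}$ is a 6-dimensional real vector space with a non-degenerate symmetric bilinear form of signature $(3,3)$. A null 3-space is a 3-dimensional linear subspace on which the bilinear form vanishes identically. The set of null 3-spaces is topologized as a subset of the Grassmannian of 3-dimensional subspaces. *)

theory Defs
  imports "HOL-Analysis.Analysis"
begin

definition nondegenerate_form :: "('a::real_vector \<Rightarrow> 'a \<Rightarrow> real) \<Rightarrow> bool" where
  "nondegenerate_form b \<longleftrightarrow> (\<forall>x. (\<forall>y. b x y = 0) \<longrightarrow> x = 0)"

text \<open>
  The signature counts positive and negative diagonal entries in a diagonalisation of a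
  symmetric bilinear form; by Sylvester's law of inertia the numbers do not depend on the
  orthogonal basis. Intended for finite-dimensional spaces, where every basis is finite.
\<close>
definition has_signature :: "('a::real_vector \<Rightarrow> 'a \<Rightarrow> real) \<Rightarrow> nat \<Rightarrow> nat \<Rightarrow> bool" where
  "has_signature b p q \<longleftrightarrow>
    (\<exists>S. independent S \<and> span S = UNIV \<and> pairwise (\<lambda>u v. b u v = 0) S \<and>
         card {v \<in> S. 0 < b v v} = p \<and> card {v \<in> S. b v v < 0} = q)"

definition subspaces_of_dim :: "nat \<Rightarrow> 'a::real_vector set set" where
  "subspaces_of_dim k = {W. subspace W \<and> dim W = k}"

text \<open>Linearly independent \<open>k\<close>-tuples, indexed by \<open>0, \<dots>, k - 1\<close>.\<close>
definition frames :: "nat \<Rightarrow> (nat \<Rightarrow> 'a::real_vector) set" where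
  "frames k = {f \<in> {..<k} \<rightarrow>\<^sub>E UNIV. inj_on f {..<k} \<and> independent (f ` {..<k})}"

definition frame_topology :: "nat \<Rightarrow> (nat \<Rightarrow> 'a::euclidean_space) topology" where
  "frame_topology k = subtopology (product_topology (\<lambda>_. euclidean) {..<k}) (frames k)"

text \<open>
  The Grassmannian carries the quotient topology of the space of \<open>k\<close>-frames under the
  map that sends a frame to its span (see \<open>quotient_map_grassmannian\<close> below).
\<close>
definition grassmannian :: "nat \<Rightarrow> 'a::euclidean_space set topology" where
  "grassmannian k = topology (\<lambda>U. U \<subseteq> subspaces_of_dim k \<and>
     openin (frame_topology k) {f \<in> frames k. span (f ` {..<k}) \<in> U})"

definition null_subspaces ::
    "('a::real_vector \<Rightarrow> 'a \<Rightarrow> real) \<Rightarrow> nat \<Rightarrow> 'a set set" where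
  "null_subspaces b k = {W \<in> subspaces_of_dim k. \<forall>x\<in>W. \<forall>y\<in>W. b x y = 0}"

definition null_grassmannian ::
    "('a::euclidean_space \<Rightarrow> 'a \<Rightarrow> real) \<Rightarrow> nat \<Rightarrow> 'a set topology" where
  "null_grassmannian b k = subtopology (grassmannian k) (null_subspaces b k)"

lemma topspace_frame_topology: "topspace (frame_topology k) = frames k"
  by (auto simp: frame_topology_def frames_def)

lemma span_frame_image:
  "(\<lambda>f. span (f ` {..<k})) ` frames k = (subspaces_of_dim k :: 'a::euclidean_space set set)"
proof (intro equalityI subsetI)
  fix W :: "'a set" assume "W \<in> (\<lambda>f. span (f ` {..<k})) ` frames k"
  then obtain f :: "nat \<Rightarrow> 'a" where f: "W = span (f ` {..<k})" "inj_on f {..<k}"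
      "independent (f ` {..<k})"
    by (auto simp: frames_def)
  then show "W \<in> subspaces_of_dim k"
    by (simp add: subspaces_of_dim_def dim_eq_card_independent card_image)
next
  fix W :: "'a set" assume W: "W \<in> subspaces_of_dim k"
  then obtain S where S: "S \<subseteq> W" "independent S" "W \<subseteq> span S" "card S = k"
    using basis_exists[of W] by (auto simp: subspaces_of_dim_def)
  then have "finite S"
    by (simp add: independent_imp_finite)
  then obtain g where g: "bij_betw g {..<k} S"
    using S(4) ex_bij_betw_nat_finite[of S] by (auto simp: atLeast0LessThan)
  define f where "f = restrict g {..<k}"
  have im: "f ` {..<k} = S" and inj: "inj_on f {..<k}"
    using g by (auto simp: f_def bij_betw_def inj_on_def)
  have "f \<in> frames k"
    using im inj S(2) by (simp add: frames_def) (simp add: f_def)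
  moreover have "span (f ` {..<k}) = W"
    using span_subspace[OF S(1,3)] W im by (simp add: subspaces_of_dim_def)
  ultimately show "W \<in> (\<lambda>f. span (f ` {..<k})) ` frames k"
    by blast
qed

lemma openin_grassmannian:
  "openin (grassmannian k) U \<longleftrightarrow> U \<subseteq> subspaces_of_dim k \<and>
     openin (frame_topology k) {f \<in> frames k. span (f ` {..<k}) \<in> U}"
proof -
  let ?P = "\<lambda>U :: 'a set set. {f \<in> frames k. span (f ` {..<k}) \<in> U}"
  have "openin (frame_topology k) (?P (S \<inter> T))"
    if "openin (frame_topology k) (?P S)" "openin (frame_topology k) (?P T)" for S T
  proof -
    have "?P (S \<inter> T) = ?P S \<inter> ?P T" by blast
    then show ?thesis using openin_Int[OF that] by (simp only:)
  qed
  moreover have "openin (frame_topology k) (?P (\<Union>\<K>))"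
    if "\<forall>K\<in>\<K>. openin (frame_topology k) (?P K)" for \<K>
  proof -
    have "?P (\<Union>\<K>) = \<Union> (?P ` \<K>)" by blast
    moreover have "openin (frame_topology k) (\<Union> (?P ` \<K>))"
      using that by (intro openin_Union) blast
    ultimately show ?thesis by (simp only:)
  qed
  ultimately have "istopology (\<lambda>U. U \<subseteq> subspaces_of_dim k \<and> openin (frame_topology k) (?P U))"
    unfolding istopology_def by (intro conjI allI impI) blast+
  then show ?thesis
    by (simp add: grassmannian_def topology_inverse')
qed

lemma topspace_grassmannian:
  "topspace (grassmannian k) = (subspaces_of_dim k :: 'a::euclidean_space set set)"
proof -
  have "{f \<in> frames k. span (f ` {..<k}) \<in> (subspaces_of_dim k :: 'a set set)} =
      topspace (frame_topology k)"
    using span_frame_image by (auto simp: topspace_frame_topology)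
  then have "openin (grassmannian k) (subspaces_of_dim k :: 'a set set)"
    unfolding openin_grassmannian by (simp only: openin_topspace) simp
  moreover have "topspace (grassmannian k) \<subseteq> (subspaces_of_dim k :: 'a set set)"
    using openin_topspace[of "grassmannian k"] unfolding openin_grassmannian by (rule conjunct1)
  ultimately show ?thesis
    by (intro subset_antisym openin_subset)
qed

lemma quotient_map_grassmannian:
  "quotient_map (frame_topology k) (grassmannian k) (\<lambda>f. span (f ` {..<k}))"
  by (simp add: quotient_map_def topspace_frame_topology topspace_grassmannian
      span_frame_image openin_grassmannian)

lemma topspace_null_grassmannian: "topspace (null_grassmannian b k) = null_subspaces b k"
  by (auto simp: null_grassmannian_def topspace_grassmannian null_subspaces_def)

end

theory Submission
  imports Defs
begin

text \<open>
  In coordinates \<open>x\<close>, \<open>y\<close> with \<open>b = |x|^2 - |y|^2\<close>, the null \<open>n\<close>-spaces of signature \<open>(n, n)\<close> are the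
  graphs \<open>y = A x\<close> of orthogonal matrices, and the graphs of \<open>A\<close> and \<open>B\<close> meet in a copy of the fixed
  space of the orthogonal matrix \<open>A\<^sup>T B\<close>. As \<open>det A = (-1)^(n - dim Fix A)\<close> for orthogonal \<open>A\<close>, the
  sign of the determinant splits the null spaces into the two required families. For \<open>n = 3\<close> each
  family is connected, because a rotation is a product of two reflections in unit vectors and the
  sphere is connected. Each is open, because the sign of \<open>det A\<close> is read off any frame of the graph.
\<close>

section \<open>Reflections and fixed spaces of orthogonal matrices\<close>

lemma orthogonal_matrix_inner:
  fixes A :: "real^'n^'n"
  shows "orthogonal_matrix A \<longleftrightarrow> (\<forall>x y. (A *v x) \<bullet> (A *v y) = x \<bullet> y)"
  using orthogonal_transformation_matrix[of "(*v) A"]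
  by (simp add: orthogonal_transformation_def)

text \<open>Given by entries so that the determinant for a coordinate axis and the continuity in
  \<open>u\<close> can be read off. It is a reflection for unit \<open>u\<close>; lemmas relying on
  this assume \<open>norm u = 1\<close>.\<close>

definition reflection_matrix :: "real^'n \<Rightarrow> real^'n^'n" where
  "reflection_matrix u = (\<chi> i j. (if i = j then 1 else 0) - 2 * u $ i * u $ j)"

lemma reflection_matrix_vector: "reflection_matrix u *v x = x - (2 * (u \<bullet> x)) *\<^sub>R u"
proof -
  have "(\<Sum>j\<in>UNIV. ((if i = j then 1 else 0) - 2 * u $ i * u $ j) * x $ j) =
      x $ i - 2 * (u \<bullet> x) * u $ i" for i
  proof -
    have "(\<Sum>j\<in>UNIV. ((if i = j then 1 else 0) - 2 * u $ i * u $ j) * x $ j) =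
        (\<Sum>j\<in>UNIV. (if i = j then x $ j else 0) - 2 * u $ i * (u $ j * x $ j))"
      by (rule sum.cong) (auto simp: algebra_simps)
    then show ?thesis
      by (simp add: sum_subtractf inner_vec_def flip: sum_distrib_left)
  qed
  then show ?thesis
    by (simp add: vec_eq_iff reflection_matrix_def matrix_vector_mult_def)
qed

lemma orthogonal_matrix_reflection:
  assumes "norm u = 1"
  shows "orthogonal_matrix (reflection_matrix u)"
  using assms unfolding orthogonal_matrix_inner norm_eq_1
  by (simp add: reflection_matrix_vector inner_diff_left inner_diff_right inner_commute
      algebra_simps)

lemma reflection_matrix_involution:
  assumes "norm u = 1"
  shows "reflection_matrix u ** reflection_matrix u = mat 1"
  using assms unfolding norm_eq_1
  by (simp add: matrix_eq reflection_matrix_vector inner_diff_right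
      flip: matrix_vector_mul_assoc)

text \<open>An orthogonal \<open>Q\<close> carrying a coordinate axis to \<open>u\<close> conjugates
  the reflection in that axis to the reflection in \<open>u\<close>, and the former is diagonal with
  a single entry -1.\<close>

lemma det_reflection_matrix:
  fixes u :: "real^'n"
  assumes u: "norm u = 1"
  shows "det (reflection_matrix u) = - 1"
proof -
  \<comment> \<open>Index types are nonempty, so some coordinate can be named.\<close>
  obtain k :: 'n where True by simp
  obtain f :: "real^'n \<Rightarrow> real^'n" where f: "orthogonal_transformation f" "f (axis k 1) = u"
    by (rule orthogonal_transformation_exists_1[OF norm_axis_1[of k] u])
  define Q where "Q = matrix f"
  have Q: "orthogonal_matrix Q" and lin: "linear f"
    using f(1) by (auto simp: Q_def orthogonal_transformation_matrix)
  have Qv: "Q *v x = f x" for x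
    by (simp add: Q_def lin matrix_works)
  have ip: "u \<bullet> f x = axis k 1 \<bullet> x" for x
    using f by (metis orthogonal_transformation_def)
  have "reflection_matrix u ** Q = Q ** reflection_matrix (axis k 1)"
    by (simp add: matrix_eq reflection_matrix_vector Qv ip linear_diff[OF lin]
        linear_cmul[OF lin] f(2) flip: matrix_vector_mul_assoc)
  then have "det (reflection_matrix u) * det Q = det Q * det (reflection_matrix (axis k 1))"
    by (metis det_mul)
  moreover have "det Q \<noteq> 0"
    using det_orthogonal_matrix[OF Q] by auto
  moreover have "det (reflection_matrix (axis k 1)) = (- 1 :: real)"
  proof -
    have "det (reflection_matrix (axis k 1)) = (\<Prod>i\<in>UNIV. reflection_matrix (axis k 1) $ i $ i :: real)"
      by (rule det_diagonal) (auto simp: reflection_matrix_def axis_def)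
    also have "\<dots> = (\<Prod>i\<in>UNIV. if i = k then - 1 else 1)"
      by (rule prod.cong) (auto simp: reflection_matrix_def axis_def)
    finally show ?thesis by simp
  qed
  ultimately show ?thesis
    by (metis mult.commute mult_cancel_right)
qed

text \<open>Take a moved vector \<open>x\<close> and reflect along its displacement
  \<open>A *v x - x\<close>. The reflection returns \<open>A *v x\<close> to \<open>x\<close>, and
  it keeps all vectors fixed by \<open>A\<close> because these are orthogonal to the displacement.
  So the fixed space gains exactly the direction \<open>x\<close>.\<close>

lemma reflection_increases_fixed_space:
  fixes A :: "real^'n^'n"
  assumes A: "orthogonal_matrix A" and "A \<noteq> mat 1"
  obtains u where "norm u = 1"
    "dim {x. (reflection_matrix u ** A) *v x = x} = Suc (dim {x. A *v x = x})"
proof -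
  obtain x where x: "A *v x \<noteq> x"
    using \<open>A \<noteq> mat 1\<close> by (metis matrix_eq matrix_vector_mul_lid)
  define w where "w = A *v x - x"
  define u where "u = w /\<^sub>R norm w"
  define R where "R = reflection_matrix u"
  have w: "w \<noteq> 0" and Ax: "A *v x = x + w" using x by (auto simp: w_def)
  have u: "norm u = 1" using w by (simp add: u_def)
  have ip: "(A *v y) \<bullet> (A *v z) = y \<bullet> z" for y z
    using A by (simp add: orthogonal_matrix_inner)
  have R: "R *v y = y - (2 * (w \<bullet> y) / (w \<bullet> w)) *\<^sub>R w" for y
    using w by (simp add: R_def u_def reflection_matrix_vector field_simps
        flip: power2_norm_eq_inner) (simp add: power2_eq_square)
  have RR: "R *v (R *v y) = y" for y
    using reflection_matrix_involution[OF u] by (simp add: R_def matrix_vector_mul_assoc)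
  \<comment> \<open>This is \<open>A *v x\<close> and \<open>x\<close> having equal length. It makes
    the coefficient of \<open>w\<close> in \<open>R *v (A *v x)\<close> equal to 1.\<close>
  have "w \<bullet> w + 2 * (x \<bullet> w) = 0"
    using ip[of x x] by (simp add: Ax inner_add_left inner_add_right inner_commute)
  then have wAx: "2 * (w \<bullet> (x + w)) = w \<bullet> w"
    by (simp add: inner_add_right inner_commute)
  let ?F = "{y. A *v y = y}"
  have sub: "subspace ?F"
    by (simp add: subspace_def matrix_vector_right_distrib matrix_vector_mult_scaleR)
  \<comment> \<open>\<open>A\<close> preserves the inner product of \<open>x\<close> and
    \<open>y\<close> and fixes \<open>y\<close>.\<close>
  have fix_orth: "w \<bullet> y = 0" if "A *v y = y" for y
    using ip[of x y] by (simp add: that w_def inner_diff_left)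
  have Rx: "R *v (A *v x) = x"
    using w wAx by (simp add: R Ax)
  \<comment> \<open>\<open>R A z = z\<close> says \<open>A z = z - c w\<close> for some \<open>c\<close>, and then \<open>A\<close> fixes \<open>z + c x\<close>.\<close>
  have "{y. (R ** A) *v y = y} = span (insert x ?F)"
  proof (intro equalityI subsetI)
    fix z assume "z \<in> {y. (R ** A) *v y = y}"
    then have "A *v z = R *v z"
      using RR[of "A *v z"] by (simp flip: matrix_vector_mul_assoc)
    then obtain c where "A *v z = z - c *\<^sub>R w"
      using R by metis
    then have "A *v (z + c *\<^sub>R x) = z + c *\<^sub>R x"
      by (simp add: matrix_vector_right_distrib matrix_vector_mult_scaleR Ax algebra_simps)
    then have "z + c *\<^sub>R x \<in> span (insert x ?F)"
      by (simp add: span_base)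
    then have "(z + c *\<^sub>R x) - c *\<^sub>R x \<in> span (insert x ?F)"
      by (intro span_diff span_scale) (auto intro: span_base)
    then show "z \<in> span (insert x ?F)" by simp
  next
    fix z assume "z \<in> span (insert x ?F)"
    moreover have "insert x ?F \<subseteq> {y. (R ** A) *v y = y}"
      using Rx by (auto simp: R fix_orth simp flip: matrix_vector_mul_assoc)
    moreover have "subspace {y. (R ** A) *v y = y}"
      by (simp add: subspace_def matrix_vector_right_distrib matrix_vector_mult_scaleR)
    ultimately show "z \<in> {y. (R ** A) *v y = y}"
      using span_minimal by blast
  qed
  moreover have "x \<notin> span ?F"
    using x by (simp add: span_eq_iff[THEN iffD2, OF sub])
  ultimately have "dim {y. (R ** A) *v y = y} = Suc (dim ?F)"
    by (simp add: dim_insert)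
  then show thesis
    using that[OF u] by (simp add: R_def)
qed

lemma fixed_space_full_iff:
  fixes A :: "real^'n^'n"
  shows "dim {x. A *v x = x} = CARD('n) \<longleftrightarrow> A = mat 1"
proof
  assume "dim {x. A *v x = x} = CARD('n)"
  then have "span {x. A *v x = x} = UNIV"
    using dim_eq_full[of "{x. A *v x = x}"] by simp
  moreover have "subspace {x. A *v x = x}"
    by (simp add: subspace_def matrix_vector_right_distrib matrix_vector_mult_scaleR)
  ultimately show "A = mat 1"
    by (metis (mono_tags, lifting) UNIV_I matrix_eq matrix_vector_mul_lid mem_Collect_eq span_eq_iff)
qed simp

lemma dim_fixed_space_le: "dim {x. A *v x = x} \<le> CARD('n)" for A :: "real^'n^'n"
  using dim_subset_UNIV[of "{x. A *v x = x}"] by simp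

text \<open>Induction on the codimension of the fixed space: a suitable reflection lowers it by one
  and flips the sign of the determinant, and codimension 0 is the identity.\<close>

theorem det_orthogonal_eq_codim_fixed_space:
  fixes A :: "real^'n^'n"
  assumes "orthogonal_matrix A"
  shows "det A = (- 1) ^ (CARD('n) - dim {x. A *v x = x})"
  using assms
proof (induction "CARD('n) - dim {x. A *v x = x}" arbitrary: A)
  case 0
  then have "A = mat 1"
    using dim_fixed_space_le[of A] fixed_space_full_iff[of A] by simp
  then show ?case by simp
next
  case (Suc m)
  have "A \<noteq> mat 1"
    using Suc.hyps(2) fixed_space_full_iff[of A] by auto
  then obtain u where u: "norm u = 1"
      "dim {x. (reflection_matrix u ** A) *v x = x} = Suc (dim {x. A *v x = x})"
    by (rule reflection_increases_fixed_space[OF Suc.prems])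
  have "orthogonal_matrix (reflection_matrix u ** A)"
    using Suc.prems u(1) by (simp add: orthogonal_matrix_mul orthogonal_matrix_reflection)
  moreover have m: "m = CARD('n) - dim {x. (reflection_matrix u ** A) *v x = x}"
    using Suc.hyps(2) u(2) by linarith
  ultimately have "det (reflection_matrix u ** A) = (- 1) ^ m"
    using Suc.hyps(1) by metis
  then show ?case
    by (simp add: det_mul det_reflection_matrix[OF u(1)] flip: Suc.hyps(2))
qed

section \<open>Rotations and rotoinversions of three-space\<close>

lemma dim_fixed_space_rotation3:
  fixes A :: "real^3^3"
  assumes "orthogonal_matrix A" "det A = 1" "A \<noteq> mat 1"
  shows "dim {x. A *v x = x} = 1"
proof -
  let ?d = "dim {x. A *v x = x}"
  have "?d \<le> 3" "?d \<noteq> 3"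
    using assms(3) dim_fixed_space_le[of A] fixed_space_full_iff[of A] by auto
  \<comment> \<open>The determinant gives the parity of the codimension. Only dimensions 1 and 3
    survive, and 3 would force the identity.\<close>
  moreover have "even (3 - ?d)"
    using det_orthogonal_eq_codim_fixed_space[OF assms(1)] assms(2)
    by (auto simp: minus_one_power_iff split: if_splits)
  ultimately show ?thesis by presburger
qed

lemma dim_fixed_space_rotoinversion3:
  fixes A :: "real^3^3"
  assumes "orthogonal_matrix A" "det A = - 1"
  shows "dim {x. A *v x = x} = 0 \<or> dim {x. A *v x = x} = 2"
proof -
  let ?d = "dim {x. A *v x = x}"
  have "?d \<le> 3"
    using dim_fixed_space_le[of A] by auto
  moreover have "odd (3 - ?d)"
    using det_orthogonal_eq_codim_fixed_space[OF assms(1)] assms(2)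
    by (auto simp: minus_one_power_iff split: if_splits)
  ultimately show ?thesis by presburger
qed

text \<open>Two reflections raise the fixed space of a nontrivial rotation from dimension 1 to 2 to
  3, where only the identity is left. As reflections are involutions, they can be moved to the other
  side.\<close>

lemma rotation3_eq_reflections:
  fixes A :: "real^3^3"
  assumes "orthogonal_matrix A" "det A = 1"
  obtains u v where "norm u = 1" "norm v = 1" "A = reflection_matrix u ** reflection_matrix v"
proof (cases "A = mat 1")
  case True
  \<comment> \<open>The identity is the square of the reflection in any unit vector.\<close>
  have "norm (axis 1 1 :: real^3) = 1" by simp
  then show ?thesis
    using that reflection_matrix_involution True by metis
next
  case False
  obtain u where u: "norm u = 1"
      "dim {x. (reflection_matrix u ** A) *v x = x} = Suc (dim {x. A *v x = x})"
    by (rule reflection_increases_fixed_space[OF assms(1) False])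
  define B where "B = reflection_matrix u ** A"
  have B: "orthogonal_matrix B"
    using u assms(1) by (simp add: B_def orthogonal_matrix_mul orthogonal_matrix_reflection)
  have dB: "dim {x. B *v x = x} = 2"
    using u(2) dim_fixed_space_rotation3[OF assms False] by (simp add: B_def)
  then have "B \<noteq> mat 1"
    using fixed_space_full_iff[of B] by auto
  then obtain v where v: "norm v = 1"
      "dim {x. (reflection_matrix v ** B) *v x = x} = Suc (dim {x. B *v x = x})"
    by (rule reflection_increases_fixed_space[OF B])
  then have "reflection_matrix v ** B = mat 1"
    using fixed_space_full_iff[of "reflection_matrix v ** B"] dB by simp
  then have "B = reflection_matrix v"
    by (metis matrix_mul_assoc matrix_mul_lid matrix_mul_rid reflection_matrix_involution v(1))
  then have "A = reflection_matrix u ** reflection_matrix v"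
    by (metis B_def matrix_mul_assoc matrix_mul_lid reflection_matrix_involution u(1))
  then show ?thesis
    using that u v by blast
qed

lemma connected_rotations3: "connected {A :: real^3^3. orthogonal_matrix A \<and> det A = 1}"
proof -
  let ?S = "sphere (0 :: real^3) 1"
  let ?f = "\<lambda>(u, v). reflection_matrix u ** reflection_matrix v"
  have "{A :: real^3^3. orthogonal_matrix A \<and> det A = 1} = ?f ` (?S \<times> ?S)"
  proof (intro equalityI subsetI)
    fix A :: "real^3^3" assume "A \<in> {A. orthogonal_matrix A \<and> det A = 1}"
    then obtain u v where "norm u = 1" "norm v = 1" "A = reflection_matrix u ** reflection_matrix v"
      using rotation3_eq_reflections by blast
    then show "A \<in> ?f ` (?S \<times> ?S)" by force
  next
    fix A assume "A \<in> ?f ` (?S \<times> ?S)"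
    then show "A \<in> {A. orthogonal_matrix A \<and> det A = 1}"
      by (auto simp: orthogonal_matrix_mul orthogonal_matrix_reflection det_mul
          det_reflection_matrix)
  qed
  moreover have "continuous_on (?S \<times> ?S) ?f"
    unfolding case_prod_unfold matrix_matrix_mult_def reflection_matrix_def
    by (intro continuous_intros)
  moreover have "connected (?S \<times> ?S)"
    by (intro connected_Times connected_sphere) auto
  ultimately show ?thesis
    by (simp only: connected_continuous_image)
qed

text \<open>In odd dimension negation flips the determinant and preserves orthogonality, so this set
  is a continuous image of the rotations.\<close>

lemma connected_rotoinversions3: "connected {A :: real^3^3. orthogonal_matrix A \<and> det A = - 1}"
proof -
  have det: "det (- A) = - det A" for A :: "real^3^3"
    by (simp add: det_3)
  have neg: "(- A) *v x = - (A *v x)" for A :: "real^3^3" and x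
    by (simp add: vec_eq_iff matrix_vector_mult_def sum_negf)
  have orth: "orthogonal_matrix (- A) \<longleftrightarrow> orthogonal_matrix A" for A :: "real^3^3"
    by (simp add: orthogonal_matrix_inner neg)
  have "{A :: real^3^3. orthogonal_matrix A \<and> det A = - 1} =
      uminus ` {A. orthogonal_matrix A \<and> det A = 1}"
  proof (intro equalityI subsetI)
    fix A :: "real^3^3" assume "A \<in> {A. orthogonal_matrix A \<and> det A = - 1}"
    then show "A \<in> uminus ` {A. orthogonal_matrix A \<and> det A = 1}"
      by (intro image_eqI[of _ _ "- A"]) (auto simp: det orth)
  qed (auto simp: det orth)
  then show ?thesis
    by (simp only:) (intro connected_continuous_image connected_rotations3 continuous_intros)
qed

section \<open>Split coordinates for a form of signature (n, n)\<close>

lemma bilinear_sum_diagonal: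
  fixes e e' :: "'n::finite \<Rightarrow> 'a::real_vector" and x y :: "real^'n"
  assumes "bilinear b" "\<And>i j. b (e i) (e' j) = (if i = j then c else 0)"
  shows "b (\<Sum>i\<in>UNIV. x $ i *\<^sub>R e i) (\<Sum>i\<in>UNIV. y $ i *\<^sub>R e' i) = c * (x \<bullet> y)"
proof -
  have "b (\<Sum>i\<in>UNIV. x $ i *\<^sub>R e i) (\<Sum>i\<in>UNIV. y $ i *\<^sub>R e' i) =
      (\<Sum>i\<in>UNIV. \<Sum>j\<in>UNIV. x $ i * (y $ j * (if i = j then c else 0)))"
    by (simp add: bilinear_sum[OF assms(1)] bilinear_lmul[OF assms(1)] bilinear_rmul[OF assms(1)]
        assms(2) sum.cartesian_product split_def mult_ac)
  also have "\<dots> = (\<Sum>i\<in>UNIV. \<Sum>j\<in>UNIV. if i = j then x $ i * (y $ j * c) else 0)"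
    by (intro sum.cong) auto
  also have "\<dots> = c * (x \<bullet> y)"
    by (simp add: inner_vec_def sum_distrib_left mult_ac)
  finally show ?thesis .
qed

text \<open>The signature supplies \<open>CARD('n)\<close> positive and \<open>CARD('n)\<close>
  negative vectors of an orthogonal basis. Scaled to values 1 and -1 and indexed by
  \<open>'n\<close>, they are the images of the two coordinate frames under
  \<open>T\<close>.\<close>

lemma split_coordinates_exist:
  fixes b :: "'a::euclidean_space \<Rightarrow> 'a \<Rightarrow> real"
  assumes dim: "DIM('a) = 2 * CARD('n)" and b: "bilinear b"
    and sig: "has_signature b CARD('n) CARD('n)"
  obtains T :: "(real^'n) \<times> (real^'n) \<Rightarrow> 'a"
  where "linear T" "bij T" "\<And>x y x' y'. b (T (x, y)) (T (x', y')) = x \<bullet> x' - y \<bullet> y'"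
proof -
  obtain S where S: "independent S" "span S = UNIV" "pairwise (\<lambda>u v. b u v = 0) S"
      "card {v \<in> S. 0 < b v v} = CARD('n)" "card {v \<in> S. b v v < 0} = CARD('n)"
    using sig by (auto simp: has_signature_def)
  define Sp Sn where "Sp = {v \<in> S. 0 < b v v}" and "Sn = {v \<in> S. b v v < 0}"
  have "finite S" using S(1) by (rule independent_imp_finite)
  then have "finite Sp" "finite Sn" by (auto simp: Sp_def Sn_def)
  then obtain g h where g: "bij_betw g (UNIV :: 'n set) Sp" and h: "bij_betw h (UNIV :: 'n set) Sn"
    using S(4,5) finite_same_card_bij[of "UNIV :: 'n set"]
    by (metis Sp_def Sn_def finite)
  have gS: "g i \<in> S" "0 < b (g i) (g i)" for i
    using g by (auto simp: bij_betw_def Sp_def)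
  have hS: "h i \<in> S" "b (h i) (h i) < 0" for i
    using h by (auto simp: bij_betw_def Sn_def)
  have orth: "b u v = 0" if "u \<in> S" "v \<in> S" "u \<noteq> v" for u v
    using S(3) that by (auto simp: pairwise_def)
  have ginj: "g i = g j \<longleftrightarrow> i = j" and hinj: "h i = h j \<longleftrightarrow> i = j" for i j
    using g h by (auto simp: bij_betw_def inj_on_def)
  have gh: "g i \<noteq> h j" for i j
    using gS(2)[of i] hS(2)[of j] by auto
  define e f where "e i = (1 / sqrt (b (g i) (g i))) *\<^sub>R g i"
    and "f i = (1 / sqrt (- b (h i) (h i))) *\<^sub>R h i" for i
  have ee: "b (e i) (e j) = (if i = j then 1 else 0)" for i j
    using gS[of i] gS[of j] orth[of "g i" "g j"] ginj[of i j]
    by (auto simp: e_def bilinear_lmul[OF b] bilinear_rmul[OF b] field_simps)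
  have ff: "b (f i) (f j) = (if i = j then - 1 else 0)" for i j
    using hS[of i] hS[of j] orth[of "h i" "h j"] hinj[of i j]
      real_sqrt_mult_self[of "- b (h i) (h i)"]
    by (auto simp: f_def bilinear_lmul[OF b] bilinear_rmul[OF b] field_simps)
  \<comment> \<open>The idle case distinction gives the shape of
    \<open>bilinear_sum_diagonal\<close> with constant 0, so that this one lemma evaluates all four
    blocks of the form.\<close>
  have ef: "b (e i) (f j) = (if i = j then 0 else 0)" and fe: "b (f i) (e j) = (if i = j then 0 else 0)" for i j
    using gS hS orth[of "g i" "h j"] orth[of "h i" "g j"] gh[of i j] gh[of j i]
    by (auto simp: e_def f_def bilinear_lmul[OF b] bilinear_rmul[OF b])
  define T :: "(real^'n) \<times> (real^'n) \<Rightarrow> 'a" where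
    "T = (\<lambda>(x, y). (\<Sum>i\<in>UNIV. x $ i *\<^sub>R e i) + (\<Sum>i\<in>UNIV. y $ i *\<^sub>R f i))"
  have lin: "linear T"
    by (rule linearI) (auto simp: T_def algebra_simps sum.distrib scaleR_sum_right)
  have bT: "b (T (x, y)) (T (x', y')) = x \<bullet> x' - y \<bullet> y'" for x y x' y'
    by (simp add: T_def bilinear_ladd[OF b] bilinear_radd[OF b]
        bilinear_sum_diagonal[of b, OF b ee] bilinear_sum_diagonal[of b, OF b ff]
        bilinear_sum_diagonal[of b, OF b ef] bilinear_sum_diagonal[of b, OF b fe])
  have "inj T"
  proof (subst linear_injective_0[OF lin], safe)
    \<comment> \<open>Pairing with \<open>T (x, 0)\<close> and \<open>T (0, y)\<close> isolates the
      two definite halves of the form.\<close>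
    fix x y assume "T (x, y) = 0"
    then have "x \<bullet> x = 0" "y \<bullet> y = 0"
      using bT[of x y x 0] bT[of x y 0 y] by (simp_all add: bilinear_lzero[OF b])
    then show "(x, y) = 0" by (simp add: zero_prod_def)
  qed
  \<comment> \<open>Injectivity suffices, since both sides have dimension
    \<open>2 * CARD('n)\<close>.\<close>
  moreover have "surj T"
    using linear_injective_isomorphism[OF lin \<open>inj T\<close>] dim
    by (metis DIM_cart DIM_prod DIM_real mult.right_neutral mult_2 dim_UNIV surj_def)
  ultimately show thesis
    using that[OF lin _ bT] by (auto simp: bij_def)
qed

section \<open>Graphs of matrices in split coordinates\<close>

definition matrix_graph :: "((real^'n) \<times> (real^'n) \<Rightarrow> 'a) \<Rightarrow> real^'n^'n \<Rightarrow> 'a set" where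
  "matrix_graph T A = range (\<lambda>x. T (x, A *v x))"

text \<open>No form is fixed here: intersections of graphs and the topology of families of graphs
  involve only the linear isomorphism \<open>T\<close>.\<close>

locale linear_coordinates =
  fixes T :: "(real^'n) \<times> (real^'n) \<Rightarrow> 'a::euclidean_space"
  assumes linear_T: "linear T" and bij_T: "bij T"
begin

lemma T_eq_iff [simp]: "T p = T q \<longleftrightarrow> p = q"
  using bij_T by (metis bij_pointE)

lemma T_inv_T [simp]: "T (inv T v) = v"
  using bij_T by (simp add: bij_is_surj surj_f_inv_f)

lemma linear_inv_T: "linear (inv T)"
proof (rule linearI)
  fix v w r
  show "inv T (v + w) = inv T v + inv T w"
    by (simp add: linear_add[OF linear_T] flip: T_eq_iff)
  show "inv T (r *\<^sub>R v) = r *\<^sub>R inv T v"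
    by (simp add: linear_cmul[OF linear_T] flip: T_eq_iff)
qed

lemma inv_T_T [simp]: "inv T (T p) = p"
  using bij_T by (simp add: bij_is_inj)

lemma linear_graph_map: "linear (\<lambda>x. T (x, A *v x))"
  by (rule linear_compose[of "\<lambda>x. (x, A *v x)" T, unfolded o_def, OF _ linear_T])
    (rule linearI, simp_all add: matrix_vector_right_distrib matrix_vector_mult_scaleR)

lemma inj_graph_map: "inj_on (\<lambda>x. T (x, A *v x)) S"
  by (simp add: inj_on_def)

lemma matrix_graph_eq_iff: "matrix_graph T A = matrix_graph T B \<longleftrightarrow> A = B"
proof
  assume eq: "matrix_graph T A = matrix_graph T B"
  have "A *v x = B *v x" for x
  proof -
    have "T (x, A *v x) \<in> matrix_graph T B"
      by (simp flip: eq) (simp add: matrix_graph_def)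
    then show ?thesis by (auto simp: matrix_graph_def)
  qed
  then show "A = B" by (simp add: matrix_eq)
qed simp

lemma matrix_graph_in_subspaces: "matrix_graph T A \<in> subspaces_of_dim CARD('n)"
proof -
  have "subspace (matrix_graph T A)"
    unfolding matrix_graph_def by (rule linear_subspace_image[OF linear_graph_map]) simp
  moreover have "dim (matrix_graph T A) = CARD('n)"
    unfolding matrix_graph_def using dim_image_eq[OF linear_graph_map inj_graph_map, of A UNIV]
    by simp
  ultimately show ?thesis by (simp add: subspaces_of_dim_def)
qed

text \<open>The graphs meet over those \<open>x\<close> with \<open>A *v x = B *v x\<close>. Since
  \<open>transpose A\<close> inverts \<open>A\<close>, these are the fixed vectors of
  \<open>transpose A ** B\<close>.\<close>

lemma dim_matrix_graph_Int:
  assumes "orthogonal_matrix A"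
  shows "dim (matrix_graph T A \<inter> matrix_graph T B) = dim {x. (transpose A ** B) *v x = x}"
proof -
  have AA: "transpose A *v (A *v z) = z" "A *v (transpose A *v z) = z" for z
    using assms by (simp_all add: matrix_vector_mul_assoc orthogonal_matrix_def
        del: vector_transpose_matrix transpose_matrix_vector)
  have "(transpose A ** B) *v x = x \<longleftrightarrow> A *v x = B *v x" for x
    by (metis AA matrix_vector_mul_assoc)
  then have "matrix_graph T A \<inter> matrix_graph T B =
      (\<lambda>x. T (x, A *v x)) ` {x. (transpose A ** B) *v x = x}"
    by (auto simp: matrix_graph_def image_iff)
  then show ?thesis
    by (simp only: dim_image_eq[OF linear_graph_map inj_graph_map])
qed

text \<open>Frames are indexed by numbers and coordinates by \<open>'n\<close>; \<open>h\<close>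
  translates between them. This serves both the standard frame of a graph and the coordinate
  matrices of an arbitrary frame.\<close>

lemma span_frame:
  assumes h: "bij_betw h {..<CARD('n)} (UNIV :: 'n set)" and L: "linear L"
    and f: "\<And>i. i < CARD('n) \<Longrightarrow> f i = L (axis (h i) 1 :: real^'n)"
  shows "span (f ` {..<CARD('n)}) = range L"
proof -
  have "f ` {..<CARD('n)} = L ` (\<lambda>k. axis k 1) ` h ` {..<CARD('n)}"
    using f by (auto simp: image_image)
  also have "h ` {..<CARD('n)} = UNIV"
    using h by (simp add: bij_betw_def)
  also have "(\<lambda>k. axis k 1 :: real^'n) ` UNIV = Basis"
    by (auto simp: Basis_vec_def)
  finally show ?thesis
    by (simp add: linear_span_image[OF L])
qed

section \<open>Connected and open families of graphs in the Grassmannian\<close>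

lemma connectedin_matrix_graphs:
  assumes "connected S"
  shows "connectedin (grassmannian CARD('n)) (matrix_graph T ` S)"
proof -
  obtain h where h: "bij_betw h {..<CARD('n)} (UNIV :: 'n set)"
    using ex_bij_betw_nat_finite[of "UNIV :: 'n set"] by (auto simp: atLeast0LessThan)
  \<comment> \<open>\<open>F\<close> lifts \<open>matrix_graph T\<close> to frames, using the points
    of the graph over the standard basis. The lift is continuous in \<open>A\<close>, and composing
    it with the quotient map shows that the graph is too.\<close>
  define F where "F A = (\<lambda>i\<in>{..<CARD('n)}. T (axis (h i) 1, A *v axis (h i) 1))" for A
  have hinj: "h i = h j \<longleftrightarrow> i = j" if "i < CARD('n)" "j < CARD('n)" for i j
    using h that by (auto simp: bij_betw_def inj_on_def)
  have span: "span (F A ` {..<CARD('n)}) = matrix_graph T A" for A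
    unfolding matrix_graph_def by (rule span_frame[OF h linear_graph_map]) (simp add: F_def)
  have inj: "inj_on (F A) {..<CARD('n)}" for A
    by (auto simp: F_def inj_on_def axis_eq_axis hinj)
  \<comment> \<open>A spanning set with no more elements than the dimension is independent.\<close>
  have "independent (F A ` {..<CARD('n)})" for A
  proof (rule card_le_dim_spanning[of _ "matrix_graph T A"])
    show "F A ` {..<CARD('n)} \<subseteq> matrix_graph T A"
      by (metis span span_superset)
    show "card (F A ` {..<CARD('n)}) \<le> dim (matrix_graph T A)"
      using matrix_graph_in_subspaces[of A] card_image[OF inj] by (simp add: subspaces_of_dim_def)
  qed (simp_all add: span)
  then have frames: "F A \<in> frames CARD('n)" for A
    using inj by (simp add: frames_def) (simp add: F_def)
  have cont: "continuous_on UNIV (\<lambda>A. T (axis (h i) 1, A *v axis (h i) 1))" for i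
    unfolding matrix_vector_mult_def
    by (intro linear_continuous_on_compose[OF _ linear_T] continuous_intros)
  have "continuous_map euclidean (product_topology (\<lambda>_. euclidean) {..<CARD('n)}) F"
    unfolding continuous_map_componentwise
    using cont by (auto simp: F_def)
  then have "continuous_map euclidean (frame_topology CARD('n)) F"
    using frames by (auto simp: frame_topology_def continuous_map_in_subtopology)
  then have "continuous_map euclidean (grassmannian CARD('n)) (matrix_graph T)"
    using continuous_map_compose[OF _ quotient_imp_continuous_map[OF quotient_map_grassmannian]]
    by (fastforce simp: o_def span)
  then show ?thesis
    using assms by (intro connectedin_continuous_map_image) auto
qed

text \<open>
  If a frame has coordinate matrices \<open>X\<close> and \<open>Y\<close>, its span is the graph of \<open>Y X\<^sup>-\<^sup>1\<close>; the sign of the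
  determinant of this matrix is the sign of the polynomial \<open>det X * det Y\<close>.
\<close>

lemma openin_matrix_graphs_det:
  assumes "s \<noteq> 0"
  shows "openin (grassmannian CARD('n)) {matrix_graph T A |A. 0 < s * det A}"
proof -
  obtain h where h: "bij_betw h {..<CARD('n)} (UNIV :: 'n set)"
    using ex_bij_betw_nat_finite[of "UNIV :: 'n set"] by (auto simp: atLeast0LessThan)
  define h' where "h' = inv_into {..<CARD('n)} h"
  have h': "h' j < CARD('n)" "i < CARD('n) \<Longrightarrow> h' (h i) = i" for i j
    using h bij_betw_inv_into[OF h] by (auto simp: h'_def bij_betw_def inv_into_f_f)
  \<comment> \<open>The columns of \<open>X f\<close> and \<open>Y f\<close> are the two coordinate
    halves of the frame vectors, so \<open>L f\<close> sends the standard basis to the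
    frame.\<close>
  define X where "X f = (\<chi> i j. fst (inv T (f (h' j))) $ i)" for f
  define Y where "Y f = (\<chi> i j. snd (inv T (f (h' j))) $ i)" for f
  define L where "L f v = T (X f *v v, Y f *v v)" for f v
  have linL: "linear (L f)" for f
    unfolding L_def
    by (rule linear_compose[of "\<lambda>x. (X f *v x, Y f *v x)" T, unfolded o_def, OF _ linear_T])
      (rule linearI, simp_all add: matrix_vector_right_distrib matrix_vector_mult_scaleR)
  have span: "span (f ` {..<CARD('n)}) = range (L f)" for f
  proof (rule span_frame[OF h linL])
    fix i assume i: "i < CARD('n)"
    have "X f *v axis (h i) 1 = fst (inv T (f i))" "Y f *v axis (h i) 1 = snd (inv T (f i))"
      using i by (simp_all add: X_def Y_def matrix_vector_mult_basis column_def h' vec_eq_iff)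
    then show "f i = L f (axis (h i) 1)"
      by (simp add: L_def)
  qed
  let ?U = "{matrix_graph T A |A. 0 < s * det A}"
  have "span (f ` {..<CARD('n)}) \<in> ?U \<longleftrightarrow> 0 < s * (det (X f) * det (Y f))" for f
  proof
    assume "span (f ` {..<CARD('n)}) \<in> ?U"
    then obtain A where A: "range (L f) = matrix_graph T A" "0 < s * det A"
      by (auto simp: span)
    have "Y f *v v = A *v (X f *v v)" for v
    proof -
      have "L f v \<in> matrix_graph T A"
        by (simp flip: A(1))
      then show ?thesis by (auto simp: L_def matrix_graph_def)
    qed
    then have "Y f = A ** X f"
      by (simp add: matrix_eq flip: matrix_vector_mul_assoc)
    \<comment> \<open>Every \<open>x\<close> is the first component of a point of the graph, so
      \<open>X f\<close> must be invertible.\<close>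
    moreover have "surj ((*v) (X f))"
      unfolding surj_def
    proof
      fix x
      have "T (x, A *v x) \<in> range (L f)"
        by (simp add: A(1)) (simp add: matrix_graph_def)
      then show "\<exists>v. x = X f *v v" by (auto simp: L_def)
    qed
    then have "det (X f) \<noteq> 0"
      by (metis invertible_det_nz invertible_right_inverse matrix_right_invertible_surjective)
    \<comment> \<open>With \<open>Y f = A ** X f\<close>, the product
      \<open>det (X f) * det (Y f)\<close> is \<open>det A\<close> times a positive square.\<close>
    then have "0 < s * det A * (det (X f))\<^sup>2"
      using A(2) by simp
    ultimately show "0 < s * (det (X f) * det (Y f))"
      by (simp add: det_mul power2_eq_square mult_ac)
  next
    assume pos: "0 < s * (det (X f) * det (Y f))"
    then have "invertible (X f)"
      by (auto simp: invertible_det_nz)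
    then obtain X' where X': "X f ** X' = mat 1" "X' ** X f = mat 1"
      by (auto simp: invertible_def)
    define A where "A = Y f ** X'"
    have YA: "Y f = A ** X f"
      by (simp add: A_def X' flip: matrix_mul_assoc)
    have "range (L f) = matrix_graph T A"
    proof -
      have "T (x, A *v x) = L f (X' *v x)" for x
        by (simp add: L_def A_def X' matrix_vector_mul_assoc)
      then have "T (x, A *v x) \<in> range (L f)" for x
        by (metis rangeI)
      moreover have "L f v \<in> matrix_graph T A" for v
        unfolding matrix_graph_def
        by (rule range_eqI[where x = "X f *v v"]) (simp add: L_def YA matrix_vector_mul_assoc)
      ultimately show ?thesis
        by (auto simp: matrix_graph_def)
    qed
    moreover have "0 < s * det A"
    proof -
      have "0 < (s * det A) * (det (X f))\<^sup>2"
        using pos by (simp add: YA det_mul power2_eq_square mult_ac)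
      then show ?thesis
        by (simp add: zero_less_mult_iff)
    qed
    ultimately show "span (f ` {..<CARD('n)}) \<in> ?U"
      by (auto simp: span)
  qed
  then have eq: "{f \<in> frames CARD('n). span (f ` {..<CARD('n)}) \<in> ?U} =
      {f \<in> topspace (frame_topology CARD('n)). s * (det (X f) * det (Y f)) \<in> {0<..}}"
    by (simp add: topspace_frame_topology)
  have coord: "continuous_map (frame_topology CARD('n)) euclidean (\<lambda>f. f (h' j))" for j
    unfolding frame_topology_def
    by (intro continuous_map_from_subtopology continuous_map_product_projection) (simp add: h')
  have contX: "continuous_map (frame_topology CARD('n)) euclideanreal (\<lambda>f. X f $ i $ j)" for i j
  proof -
    have "continuous_on UNIV (\<lambda>v. fst (inv T v) $ i)"
      by (intro continuous_intros linear_continuous_on linear_conv_bounded_linear[THEN iffD1, OF linear_inv_T])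
    then show ?thesis
      using continuous_map_compose[OF coord[of j], of euclidean "\<lambda>v. fst (inv T v) $ i"]
      by (simp add: X_def o_def)
  qed
  have contY: "continuous_map (frame_topology CARD('n)) euclideanreal (\<lambda>f. Y f $ i $ j)" for i j
  proof -
    have "continuous_on UNIV (\<lambda>v. snd (inv T v) $ i)"
      by (intro continuous_intros linear_continuous_on linear_conv_bounded_linear[THEN iffD1, OF linear_inv_T])
    then show ?thesis
      using continuous_map_compose[OF coord[of j], of euclidean "\<lambda>v. snd (inv T v) $ i"]
      by (simp add: Y_def o_def)
  qed
  \<comment> \<open>Expanding the determinants leaves a polynomial in continuous entries.\<close>
  have "continuous_map (frame_topology CARD('n)) euclideanreal (\<lambda>f. s * (det (X f) * det (Y f)))"
    unfolding det_def
    by (intro continuous_map_real_mult continuous_map_sum continuous_map_prod contX contY) auto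
  then have "openin (frame_topology CARD('n)) {f \<in> frames CARD('n). span (f ` {..<CARD('n)}) \<in> ?U}"
    unfolding eq by (rule openin_continuous_map_preimage) simp
  then show ?thesis
    using matrix_graph_in_subspaces by (auto simp: openin_grassmannian)
qed

section \<open>Null subspaces as graphs of orthogonal matrices\<close>

lemma null_subspaces_eq_orthogonal_graphs:
  assumes b: "\<And>x y x' y'. b (T (x, y)) (T (x', y')) = x \<bullet> x' - y \<bullet> y'"
  shows "null_subspaces b CARD('n) = matrix_graph T ` {A. orthogonal_matrix A}"
proof (intro equalityI subsetI)
  fix W assume "W \<in> matrix_graph T ` {A. orthogonal_matrix A}"
  then obtain A where A: "orthogonal_matrix A" "W = matrix_graph T A" by auto
  have "b v w = 0" if "v \<in> W" "w \<in> W" for v w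
    using that A by (auto simp: matrix_graph_def b orthogonal_matrix_inner)
  then show "W \<in> null_subspaces b CARD('n)"
    using matrix_graph_in_subspaces A(2) by (auto simp: null_subspaces_def)
next
  fix W assume W: "W \<in> null_subspaces b CARD('n)"
  then have null: "b v w = 0" if "v \<in> W" "w \<in> W" for v w
    using that by (auto simp: null_subspaces_def)
  have "dim (UNIV :: (real^'n) set) = dim W" "subspace W"
    using W by (auto simp: null_subspaces_def subspaces_of_dim_def)
  \<comment> \<open>The isometry refers to the Euclidean norm of \<open>'a\<close>, not to
    \<open>b\<close>. It parametrises \<open>W\<close> linearly, and norm preservation yields
    injectivity.\<close>
  then obtain L where L: "linear L" "L ` (UNIV :: (real^'n) set) = W"
      "\<And>x. norm (L x) = norm x"
    using isometry_subspaces[of "UNIV :: (real^'n) set" W] by auto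
  define P where "P v = fst (inv T (L v))" for v
  define Q where "Q v = snd (inv T (L v))" for v
  have LT: "L v = T (P v, Q v)" for v
    by (simp add: P_def Q_def)
  have linP: "linear P" and linQ: "linear Q"
    unfolding P_def Q_def
    by (auto intro!: linear_compose[of _ fst, unfolded o_def] linear_compose[of _ snd, unfolded o_def]
        linear_compose[of _ "inv T", unfolded o_def] L(1) linear_inv_T linear_fst linear_snd)
  \<comment> \<open>The form is negative definite where the first coordinate vanishes, so a null
    space meets that part only in 0. Equality of dimensions then makes \<open>P\<close> invertible,
    and \<open>W\<close> is the graph of \<open>Q\<close> after the inverse of
    \<open>P\<close>.\<close>
  have "inj P"
  proof (subst linear_injective_0[OF linP], safe)
    fix v assume "P v = 0"
    moreover have "b (L v) (L v) = 0" using L(2) by (intro null) auto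
    ultimately have "L v = T 0"
      by (simp add: LT b zero_prod_def)
    then show "v = 0"
      using L(3)[of v] linear_0[OF linear_T] by simp
  qed
  then obtain P' where P': "linear P'" "\<And>x. P' (P x) = x" "\<And>x. P (P' x) = x"
    using linear_injective_isomorphism[OF linP] by auto
  define A where "A = matrix (Q \<circ> P')"
  have A: "A *v x = Q (P' x)" for x
    using matrix_works[of "Q \<circ> P'"] linear_compose[OF P'(1) linQ] by (simp add: A_def)
  have "W = matrix_graph T A"
  proof -
    have "L v = T (P v, A *v P v)" "T (x, A *v x) = L (P' x)" for v x
      by (simp_all add: A LT P')
    then show ?thesis
      unfolding matrix_graph_def by (auto simp flip: L(2))
  qed
  moreover have "orthogonal_matrix A"
    unfolding orthogonal_matrix_inner
  proof (intro allI)
    fix x y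
    have "b (T (x, A *v x)) (T (y, A *v y)) = 0"
      using \<open>W = matrix_graph T A\<close> by (intro null) (auto simp: matrix_graph_def)
    then show "(A *v x) \<bullet> (A *v y) = x \<bullet> y" by (simp add: b)
  qed
  ultimately show "W \<in> matrix_graph T ` {A. orthogonal_matrix A}" by blast
qed

end

section \<open>Components and the decomposition of the null 3-spaces\<close>

lemma connected_components_of_eq_pair:
  assumes A: "connectedin X A" "openin X A" "A \<noteq> {}"
    and B: "connectedin X B" "openin X B" "B \<noteq> {}"
    and AB: "A \<union> B = topspace X" "A \<inter> B = {}"
  shows "connected_components_of X = {A, B}"
proof -
  \<comment> \<open>The component contains \<open>C\<close> because \<open>C\<close> is connected,
    and it is no larger because the open sets \<open>C\<close> and \<open>D\<close> would separate
    it. Stated for generic \<open>C\<close> and \<open>D\<close> to serve both pieces.\<close>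
  have comp: "connected_component_of_set X x = C"
    if C: "connectedin X C" "openin X C" and D: "openin X D" "C \<union> D = topspace X" "C \<inter> D = {}"
      and x: "x \<in> C" for C D x
  proof
    show "C \<subseteq> connected_component_of_set X x"
      using C(1) x by (rule connected_component_of_maximal)
    have K: "connectedin X (connected_component_of_set X x)"
      by (rule connectedin_connected_component_of)
    have "x \<in> connected_component_of_set X x"
      using C x by (simp add: connected_component_of_refl openin_subset[THEN subsetD])
    moreover have "connected_component_of_set X x \<subseteq> C \<union> D"
      using connected_component_of_subset_topspace D(2) by metis
    ultimately show "connected_component_of_set X x \<subseteq> C"
      using K C(2) D(1,3) x unfolding connectedin by blast
  qed
  have a: "connected_component_of_set X x = A" if "x \<in> A" for x
    using comp[OF A(1,2) B(2) AB that] .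
  have b: "connected_component_of_set X x = B" if "x \<in> B" for x
    using comp[OF B(1,2) A(2)] AB that by (metis inf_commute sup_commute)
  have "connected_components_of X = connected_component_of_set X ` (A \<union> B)"
    by (simp add: connected_components_of_def AB(1))
  also have "\<dots> = {A, B}"
    unfolding image_Un using a b A(3) B(3) by force
  finally show ?thesis .
qed

theorem proposition1:
  fixes b :: "'a::euclidean_space \<Rightarrow> 'a \<Rightarrow> real"
  assumes "DIM('a) = 6"
    and "bilinear b"
    and "\<And>x y. b x y = b y x"
    and "nondegenerate_form b"
    and "has_signature b 3 3"
  shows "\<exists>\<A> \<B>. \<A> \<noteq> \<B> \<and>
      connected_components_of (null_grassmannian b 3) = {\<A>, \<B>} \<and>
      \<A> \<union> \<B> = null_subspaces b 3 \<and> \<A> \<inter> \<B> = {} \<and>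
      (\<forall>V\<in>\<A>. \<forall>W\<in>\<A>. V \<noteq> W \<longrightarrow> dim (V \<inter> W) = 1) \<and>
      (\<forall>V\<in>\<B>. \<forall>W\<in>\<B>. V \<noteq> W \<longrightarrow> dim (V \<inter> W) = 1) \<and>
      (\<forall>V\<in>\<A>. \<forall>W\<in>\<B>. dim (V \<inter> W) = 0 \<or> dim (V \<inter> W) = 2)"
proof -
  obtain T :: "(real^3) \<times> (real^3) \<Rightarrow> 'a" where T: "linear T" "bij T"
      "\<And>x y x' y'. b (T (x, y)) (T (x', y')) = x \<bullet> x' - y \<bullet> y'"
    by (rule split_coordinates_exist[where 'n = 3 and b = b]) (use assms(1,2,5) in auto)
  interpret linear_coordinates T
    by (rule linear_coordinates.intro[OF T(1,2)])
  define G where "G s = matrix_graph T ` {A. orthogonal_matrix A \<and> det A = s}" for s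
  have null: "null_subspaces b 3 = matrix_graph T ` {A. orthogonal_matrix A}"
    using null_subspaces_eq_orthogonal_graphs[of b] T(3) by simp
  have det: "det A = 1 \<or> det A = - 1" if "orthogonal_matrix A" for A :: "real^3^3"
    using that by (rule det_orthogonal_matrix)
  have union: "G 1 \<union> G (- 1) = null_subspaces b 3"
    using det by (auto simp: G_def null)
  have disj: "G 1 \<inter> G (- 1) = {}"
    by (auto simp: G_def matrix_graph_eq_iff)
  have conn: "connectedin (null_grassmannian b 3) (G 1)"
    "connectedin (null_grassmannian b 3) (G (- 1))"
    using connectedin_matrix_graphs[OF connected_rotations3]
      connectedin_matrix_graphs[OF connected_rotoinversions3] union
    by (auto simp: null_grassmannian_def connectedin_subtopology G_def)
  have "open": "openin (null_grassmannian b 3) (G s)" if s: "s = 1 \<or> s = - 1" for s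
  proof -
    \<comment> \<open>Orthogonal determinants are 1 or -1, so an open sign condition on all matrices
      cuts out exactly one family.\<close>
    have "0 < s * det A \<longleftrightarrow> det A = s" if "orthogonal_matrix A" for A :: "real^3^3"
      using det[OF that] s by auto
    then have "G s = null_subspaces b 3 \<inter> {matrix_graph T A |A. 0 < s * det A}"
      by (auto simp: G_def null matrix_graph_eq_iff)
    then show ?thesis
      using openin_matrix_graphs_det[of s] s
      by (auto simp: null_grassmannian_def openin_subtopology_alt)
  qed
  have "mat 1 \<in> {A :: real^3^3. orthogonal_matrix A \<and> det A = 1}"
    by (simp add: orthogonal_matrix_id)
  moreover have "reflection_matrix (axis 1 1) \<in> {A :: real^3^3. orthogonal_matrix A \<and> det A = - 1}"
    by (simp add: orthogonal_matrix_reflection det_reflection_matrix)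
  ultimately have ne: "G 1 \<noteq> {}" "G (- 1) \<noteq> {}"
    unfolding G_def by blast+
  \<comment> \<open>By multiplicativity \<open>transpose A ** B\<close> is a rotation for two graphs
    of one family and a rotoinversion for graphs of different families; it is the identity only when
    the graphs coincide.\<close>
  have int: "dim (matrix_graph T A \<inter> matrix_graph T B) = dim {x. (transpose A ** B) *v x = x}"
    "orthogonal_matrix (transpose A ** B)" "det (transpose A ** B) = det A * det B"
    "transpose A ** B = mat 1 \<longleftrightarrow> A = B"
    if "orthogonal_matrix A" "orthogonal_matrix B" for A B
  proof -
    show "transpose A ** B = mat 1 \<longleftrightarrow> A = B"
      using that by (metis matrix_mul_assoc matrix_mul_lid matrix_mul_rid orthogonal_matrix_def)
  qed (use that in \<open>simp_all add: dim_matrix_graph_Int orthogonal_matrix_mul det_mul\<close>)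
  have same: "dim (V \<inter> W) = 1" if VW: "V \<in> G s" "W \<in> G s" "V \<noteq> W" "s * s = 1" for V W s
  proof -
    obtain A B where "V = matrix_graph T A" "W = matrix_graph T B" "orthogonal_matrix A"
        "orthogonal_matrix B" "det A = s" "det B = s"
      using VW(1,2) by (auto simp: G_def)
    then show ?thesis
      using VW(3,4) int[of A B] dim_fixed_space_rotation3[of "transpose A ** B"] by auto
  qed
  have diff: "dim (V \<inter> W) = 0 \<or> dim (V \<inter> W) = 2" if VW: "V \<in> G 1" "W \<in> G (- 1)" for V W
  proof -
    obtain A B where "V = matrix_graph T A" "W = matrix_graph T B" "orthogonal_matrix A"
        "orthogonal_matrix B" "det A = 1" "det B = - 1"
      using VW by (auto simp: G_def)
    then show ?thesis
      using int[of A B] dim_fixed_space_rotoinversion3[of "transpose A ** B"] by auto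
  qed
  have "connected_components_of (null_grassmannian b 3) = {G 1, G (- 1)}"
    using conn "open" ne union disj
    by (intro connected_components_of_eq_pair) (auto simp: topspace_null_grassmannian)
  moreover have "G 1 \<noteq> G (- 1)" using ne disj by auto
  ultimately show ?thesis
    using union disj same[of _ 1] same[of _ "- 1"] diff
    by (intro exI[of _ "G 1"] exI[of _ "G (- 1)"]) auto
qed

end
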